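(* Let $\alpha\in(0,1)$, $m\ge1$, $\mathcal Y\subset\mathbb R$. Let $\mathbf p=(p^{(y)}_i)_{1\le i\le m,\,y\in\mathcal Y}$ be a family of random variables with values in $[0,1]$ and $Y=(Y_{n+i})_{1\le i\le m}$ a vector with values in $\mathcal Y$ (random or deterministic). Write $\mathbf p_{-i}=(p^{(y)}_j)_{j\ne i,\,y\in\mathcal Y}$. Assume: (P) there exist random elements (multivariate random variables) $W_1,\dots,W_m$ such that for every $i\in\{1,\dots,m\}$: (i) almost surely $\mathbf p_{-i}=\Psi_i(p^{(Y_{n+i})}_i,W_i)$, where $u\in[0,1]\mapsto\Psi_i(u,W_i)$ is coordinate-wise nondecreasing; (ii) $\mathbb P(p^{(Y_{n+i})}_i\le t\mid W_i)\le t$ for all $t\in[0,1]$. Let $\mathcal S=\mathcal S(\mathbf p)\subset\{1,\dots,m\}$ be a selection rule, i.e. a measurable function of $\mathbf p$ valued in the subsets of $\{1,\dots,m\}$, which is concordant in the following sense: (S) for every $i\in\{1,\dots,m\}$, the quantity $$s_i^{\min}(\mathbf p_{-i})=\min\big\{|\mathcal S(z,\mathbf p_{-i})| \,:\, z\in[0,1]^{\mathcal Y},\ i\in\mathcal S(z,\mathbf p_{-i})\big\}$$ (equal to $0$ if the set is empty) is a coordinate-wise nonincreasing function of $\mathbf p_{-i}$. Then the procedure $\mathcal R_\alpha=\big(\mathcal C_{n+i}\big)_{i\in\mathcal S}$ with $\mathcal C_{n+i}=\{y\in\mathcal Y: p^{(y)}_i>\alpha\,(1\vee s_i^{\min}(\mathbf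 p_{-i}))/m\}$ satisfies $$\mathbb E\big[\mathrm{FCP}(\mathcal R_\alpha,Y)\big]\le\alpha,$$ where the expectation is with respect to the same probability as in (P)(ii).
   Context: $\mathcal S(z,\mathbf p_{-i})$ denotes the selection rule evaluated at the family whose $i$-th row $(p_i^{(y)})_{y\in\mathcal Y}$ is replaced by $z$ and whose other rows are $\mathbf p_{-i}$. For a selective prediction set procedure $\mathcal R=(\mathcal C_{n+i})_{i\in\mathcal S}$, the false coverage proportion is $\mathrm{FCP}(\mathcal R,Y)=\frac{\sum_{i\in\mathcal S}\mathbf 1\{Y_{n+i}\notin\mathcal C_{n+i}\}}{\max(1,|\mathcal S|)}$. $a\vee b=\max(a,b)$.
   Formalization: The formal statement makes explicit that $p_i^{(Y_{n+i})}$ is a random variable and that $\Psi_i(u,\cdot)$ is measurable for each fixed $u$; with a non-measurable $\Psi_i$ the bound can fail. *)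

theory Defs
  imports "HOL-Probability.Probability"
begin

text \<open>A row (p_i^(y)) with y in the label set \<open>Ys\<close> is an element of [0,1]^Ys, a family is an
  \<open>I\<close>-indexed family of rows; both carry the product sigma-algebra. Rows and families are
  extensional (value \<open>undefined\<close> off the index set), so the pointwise order \<open>\<le>\<close> on functions,
  restricted to \<open>space (family_space I Ys)\<close>, is exactly the coordinate-wise order.\<close>

definition row_space :: "real set \<Rightarrow> (real \<Rightarrow> real) measure" where
  "row_space Ys = (\<Pi>\<^sub>M y\<in>Ys. restrict_space borel {0..1})"

definition family_space :: "nat set \<Rightarrow> real set \<Rightarrow> (nat \<Rightarrow> real \<Rightarrow> real) measure" where
  "family_space I Ys = (\<Pi>\<^sub>M i\<in>I. row_space Ys)"

lemma space_row_space: "space (row_space Ys) = Ys \<rightarrow>\<^sub>E {0..1}"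
  by (simp add: row_space_def space_PiM)

lemma space_family_space: "space (family_space I Ys) = I \<rightarrow>\<^sub>E (Ys \<rightarrow>\<^sub>E {0..1})"
  by (simp add: family_space_def space_PiM space_row_space)

text \<open>With \<open>I = {1..m}\<close> this is the realised family p, with \<open>I = {1..m} - {i}\<close> it is p_{-i}.\<close>

definition family_at ::
    "nat set \<Rightarrow> real set \<Rightarrow> (nat \<Rightarrow> real \<Rightarrow> 'a \<Rightarrow> real) \<Rightarrow> 'a \<Rightarrow> (nat \<Rightarrow> real \<Rightarrow> real)" where
  "family_at I Ys p \<omega> = (\<lambda>j\<in>I. \<lambda>y\<in>Ys. p j y \<omega>)"

lemma measurable_family_at:
  assumes "\<And>i y. i \<in> I \<Longrightarrow> y \<in> Ys \<Longrightarrow> p i y \<in> borel_measurable M"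
    and "\<And>i y \<omega>. i \<in> I \<Longrightarrow> y \<in> Ys \<Longrightarrow> \<omega> \<in> space M \<Longrightarrow> p i y \<omega> \<in> {0..1}"
  shows "family_at I Ys p \<in> M \<rightarrow>\<^sub>M family_space I Ys"
  unfolding family_at_def[abs_def] family_space_def row_space_def
  by (intro measurable_restrict measurable_restrict_space2) (use assms in auto)

text \<open>\<open>q\<close> stands for p_{-i}; S(z, p_{-i}) is \<open>sel (q(i := z))\<close>. For a rule \<open>sel\<close> with values in
  the subsets of a fixed finite set, the set of cardinalities is finite, so \<open>Min\<close> is a genuine
  minimum.\<close>

definition s_min ::
    "real set \<Rightarrow> ((nat \<Rightarrow> real \<Rightarrow> real) \<Rightarrow> nat set) \<Rightarrow> nat \<Rightarrow> (nat \<Rightarrow> real \<Rightarrow> real) \<Rightarrow> nat" where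
  "s_min Ys sel i q =
     (let K = {card (sel (q(i := z))) | z. z \<in> Ys \<rightarrow>\<^sub>E {0..1} \<and> i \<in> sel (q(i := z))}
      in if K = {} then 0 else Min K)"

definition prediction_set ::
    "real set \<Rightarrow> nat \<Rightarrow> real \<Rightarrow> ((nat \<Rightarrow> real \<Rightarrow> real) \<Rightarrow> nat set)
      \<Rightarrow> (nat \<Rightarrow> real \<Rightarrow> real) \<Rightarrow> nat \<Rightarrow> real set" where
  "prediction_set Ys m \<alpha> sel P i =
     {y \<in> Ys. P i y >
        \<alpha> * real (max 1 (s_min Ys sel i (restrict P ({1..m} - {i})))) / real m}"

text \<open>\<open>Y i\<close> and \<open>C i\<close> stand for Y_{n+i} and C_{n+i}: the offset n only labels the test points.\<close>

definition FCP :: "nat set \<Rightarrow> (nat \<Rightarrow> real set) \<Rightarrow> (nat \<Rightarrow> real) \<Rightarrow> real" where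
  "FCP S C Y = (\<Sum>i\<in>S. of_bool (Y i \<notin> C i)) / real (max 1 (card S))"

text \<open>P(E | W), where \<open>W\<close> is a random element of the measurable space \<open>N\<close>: conditional
  expectation given the sigma-algebra generated by \<open>W\<close>.\<close>

definition prob_given :: "'a measure \<Rightarrow> 'w measure \<Rightarrow> ('a \<Rightarrow> 'w) \<Rightarrow> 'a set \<Rightarrow> 'a \<Rightarrow> real" where
  "prob_given M N W E = real_cond_exp M (vimage_algebra (space M) W N) (indicat_real E)"

end

theory Submission
  imports Defs "HOL-Library.Nat_Bijection"
begin

text \<open>
  Put \<open>c = \<alpha> / m\<close>, \<open>U = p\<^sub>i\<close> at the true label, and \<open>A = max 1 (s_min p\<^sub>-\<^sub>i)\<close>. If \<open>i\<close> is selected then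
  \<open>A\<close> is at most the number of selected points (\<open>s_min_le_card\<close>), so the share of \<open>i\<close> in the false
  coverage proportion is at most \<open>1 / A\<close> when \<open>U \<le> c * A\<close>, and \<open>0\<close> otherwise. It suffices that
  this bound has expectation at most \<open>c\<close> for each of the \<open>m\<close> points.

  Given \<open>W\<close>, the number \<open>A = g U\<close> is a nonincreasing integer function of \<open>U\<close>. Let \<open>k\<close> be the
  least integer with \<open>g (c * k) \<le> k\<close>. Monotonicity shows that \<open>U \<le> c * g U\<close> forces both
  \<open>k \<le> g U\<close> and \<open>U \<le> c * k\<close> (\<open>antitone_first_crossing\<close>). Hence the random level \<open>c * A\<close>,
  which depends on \<open>U\<close>, can be replaced by the level \<open>c * k\<close>, which depends on \<open>W\<close> alone:
  the bound is at most \<open>1 / k\<close> on \<open>U \<le> c * k\<close>, of conditional expectation at most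
  \<open>c * k / k = c\<close> (\<open>superuniform_random_level\<close>, \<open>expected_error_share_le\<close>).

  The other half of the work is measurability. The number \<open>s_min\<close> is defined by an existential
  quantifier over the rows \<open>z\<close>, an uncountable one, so its sublevel sets are projections of
  measurable sets and need not be measurable. Monotonicity alone does not repair this: a monotone
  function on the unit square can be arbitrary along the antidiagonal. Such projections
  are, however, measurable up to null sets for every finite measure
  (\<open>measurable_projection_cube\<close>), because they are results of the Suslin operation on measurable
  sets (\<open>Suslin_sets_projection\<close>) and the completion of a finite measure is closed under that
  operation (\<open>Suslin_sets_subset_completion\<close>). This is applied twice: on the probability space
  itself, to make the false coverage proportion measurable, and to the law of \<open>W\<close>, to make
  \<open>k\<close> equal almost surely to a measurable function of \<open>W\<close>.
\<close>

section \<open>The Suslin operation\<close>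

text \<open>A scheme is usually indexed by finite sequences. Here \<open>G n \<sigma>\<close> stands for the set attached to
  the initial segment of \<open>\<sigma>\<close> of length \<open>n\<close>; with infinite sequences, the interleavings below
  become reindexings of \<open>\<sigma>\<close>.\<close>

definition Suslin_scheme :: "'x set set \<Rightarrow> (nat \<Rightarrow> (nat \<Rightarrow> nat) \<Rightarrow> 'x set) \<Rightarrow> bool" where
  "Suslin_scheme E G \<longleftrightarrow> (\<forall>n \<sigma>. G n \<sigma> \<in> E) \<and>
     (\<forall>n \<sigma> \<tau>. (\<forall>i<n. \<sigma> i = \<tau> i) \<longrightarrow> G n \<sigma> = G n \<tau>)"

definition Suslin_kernel :: "(nat \<Rightarrow> (nat \<Rightarrow> nat) \<Rightarrow> 'x set) \<Rightarrow> 'x set" where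
  "Suslin_kernel G = {x. \<exists>\<sigma>. \<forall>n. x \<in> G n \<sigma>}"

definition Suslin_sets :: "'x set set \<Rightarrow> 'x set set" where
  "Suslin_sets E = Suslin_kernel ` Collect (Suslin_scheme E)"

lemma Suslin_schemeD:
  assumes "Suslin_scheme E G"
  shows "G n \<sigma> \<in> E" and "(\<And>i. i < n \<Longrightarrow> \<sigma> i = \<tau> i) \<Longrightarrow> G n \<sigma> = G n \<tau>"
  using assms by (simp_all add: Suslin_scheme_def)

lemma Suslin_setsI:
  fixes G :: "nat \<Rightarrow> (nat \<Rightarrow> nat) \<Rightarrow> 'x set"
  assumes "\<And>n \<sigma>. G n \<sigma> \<in> E"
    and "\<And>n \<sigma> \<tau>. (\<And>i. i < n \<Longrightarrow> \<sigma> i = \<tau> i) \<Longrightarrow> G n \<sigma> = G n \<tau>"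
    and "A = {x. \<exists>\<sigma>. \<forall>n. x \<in> G n \<sigma>}"
  shows "A \<in> Suslin_sets E"
proof -
  have "Suslin_scheme E G"
    unfolding Suslin_scheme_def by (intro conjI allI impI assms(1,2)) blast
  moreover have "A = Suslin_kernel G"
    by (simp add: assms(3) Suslin_kernel_def)
  ultimately show ?thesis
    by (simp add: Suslin_sets_def)
qed

lemma Suslin_setsE:
  assumes "A \<in> Suslin_sets E"
  obtains G where "Suslin_scheme E G" and "A = {x. \<exists>\<sigma>. \<forall>n. x \<in> G n \<sigma>}"
  using assms by (auto simp: Suslin_sets_def Suslin_kernel_def)

lemma Suslin_sets_choice:
  assumes "\<And>k. A k \<in> Suslin_sets E"
  shows "\<exists>G. \<forall>k. Suslin_scheme E (G k) \<and> A k = {x. \<exists>\<sigma>. \<forall>n. x \<in> G k n \<sigma>}"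
proof (rule choice, rule allI)
  fix k
  show "\<exists>G. Suslin_scheme E G \<and> A k = {x. \<exists>\<sigma>. \<forall>n. x \<in> G n \<sigma>}"
    using Suslin_setsE[OF assms[of k]] by metis
qed

lemma Suslin_sets_basic: "A \<in> E \<Longrightarrow> A \<in> Suslin_sets E"
  by (rule Suslin_setsI[where G="\<lambda>_ _. A"]) auto

lemma Suslin_sets_subset_Pow: "E \<subseteq> Pow X \<Longrightarrow> Suslin_sets E \<subseteq> Pow X"
proof
  fix A assume E: "E \<subseteq> Pow X" and "A \<in> Suslin_sets E"
  then obtain G where "Suslin_scheme E G" "A = {x. \<exists>\<sigma>. \<forall>n. x \<in> G n \<sigma>}"
    by (auto elim: Suslin_setsE)
  then have "\<And>\<sigma>. G 0 \<sigma> \<subseteq> X"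
    using E Suslin_schemeD(1) by blast
  with \<open>A = _\<close> show "A \<in> Pow X"
    by blast
qed

text \<open>The first term of the sequence chooses the member of the union, and the rest is a branch of its
  scheme. Nothing has been chosen at level \<open>0\<close>, which is why the whole space is needed there.\<close>

lemma Suslin_sets_UN:
  assumes A: "\<And>k::nat. A k \<in> Suslin_sets E" and E: "E \<subseteq> Pow X" "X \<in> E"
  shows "(\<Union>k. A k) \<in> Suslin_sets E"
proof -
  obtain G where G_all: "\<forall>k. Suslin_scheme E (G k) \<and> A k = {x. \<exists>\<sigma>. \<forall>n. x \<in> G k n \<sigma>}"
    using Suslin_sets_choice[of A E, OF A] by (rule exE)
  have scheme: "Suslin_scheme E (G k)" for k
    using G_all by simp
  have A_eq: "A k = {x. \<exists>\<sigma>. \<forall>n. x \<in> G k n \<sigma>}" for k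
    using G_all by simp
  note G = Suslin_schemeD[OF scheme]
  define H where "H n \<sigma> = (case n of 0 \<Rightarrow> X | Suc n' \<Rightarrow> G (\<sigma> 0) n' (\<lambda>i. \<sigma> (Suc i)))" for n and \<sigma> :: "nat \<Rightarrow> nat"
  show ?thesis
  proof (rule Suslin_setsI[where G=H])
    show "H n \<sigma> \<in> E" for n \<sigma>
      by (auto simp: H_def E G(1) split: nat.split)
    show "H n \<sigma> = H n \<tau>" if "\<And>i. i < n \<Longrightarrow> \<sigma> i = \<tau> i" for n \<sigma> \<tau>
      using that by (auto simp: H_def split: nat.split intro!: G(2))
    have "(\<exists>k \<sigma>. \<forall>n. x \<in> G k n \<sigma>) \<longleftrightarrow> (\<exists>\<sigma>. \<forall>n. x \<in> H n \<sigma>)" for x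
    proof
      assume "\<exists>k \<sigma>. \<forall>n. x \<in> G k n \<sigma>"
      then obtain k \<sigma> where *: "\<forall>n. x \<in> G k n \<sigma>" by blast
      then have "x \<in> X" using G(1) E(1) by blast
      then have "\<forall>n. x \<in> H n (case_nat k \<sigma>)"
        using * by (auto simp: H_def split: nat.split)
      then show "\<exists>\<sigma>. \<forall>n. x \<in> H n \<sigma>" by blast
    next
      assume "\<exists>\<sigma>. \<forall>n. x \<in> H n \<sigma>"
      then obtain \<sigma> where *: "\<And>n. x \<in> H n \<sigma>" by blast
      have "\<forall>n. x \<in> G (\<sigma> 0) n (\<lambda>i. \<sigma> (Suc i))"
        using *[of "Suc n" for n] by (auto simp: H_def)
      then show "\<exists>k \<sigma>. \<forall>n. x \<in> G k n \<sigma>" by blast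
    qed
    then show "(\<Union>k. A k) = {x. \<exists>\<sigma>. \<forall>n. x \<in> H n \<sigma>}"
      by (simp add: A_eq set_eq_iff)
  qed
qed

lemma prod_encode_less_right: "j < n \<Longrightarrow> prod_encode (k, j) < prod_encode (k, n)"
proof -
  assume "j < n"
  moreover have "strict_mono (\<lambda>n. prod_encode (k, n))"
    by (simp add: strict_mono_Suc_iff prod_encode_def)
  ultimately show ?thesis by (rule strict_monoD[rotated])
qed

text \<open>One sequence encodes a sequence of branches, one for each scheme, along the pairing of
  indices. The set at level \<open>n\<close> of the \<open>k\<close>-th scheme is placed at level \<open>prod_encode (k, n)\<close>, by which
  time all the terms of the \<open>k\<close>-th branch that it needs have been read.\<close>

lemma Suslin_sets_INT:
  assumes A: "\<And>k::nat. A k \<in> Suslin_sets E"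
  shows "(\<Inter>k. A k) \<in> Suslin_sets E"
proof -
  obtain G where G_all: "\<forall>k. Suslin_scheme E (G k) \<and> A k = {x. \<exists>\<sigma>. \<forall>n. x \<in> G k n \<sigma>}"
    using Suslin_sets_choice[of A E, OF A] by (rule exE)
  have scheme: "Suslin_scheme E (G k)" for k
    using G_all by simp
  have A_eq: "A k = {x. \<exists>\<sigma>. \<forall>n. x \<in> G k n \<sigma>}" for k
    using G_all by simp
  note G = Suslin_schemeD[OF scheme]
  define H where "H N \<sigma> = (case prod_decode N of (k, n) \<Rightarrow> G k n (\<lambda>j. \<sigma> (prod_encode (k, j))))"
    for N and \<sigma> :: "nat \<Rightarrow> nat"
  have H: "H (prod_encode (k, n)) \<sigma> = G k n (\<lambda>j. \<sigma> (prod_encode (k, j)))" for k n \<sigma>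
    by (simp add: H_def)
  show ?thesis
  proof (rule Suslin_setsI[where G=H])
    show "H n \<sigma> \<in> E" for n \<sigma>
      by (auto simp: H_def G(1) split: prod.split)
    show "H N \<sigma> = H N \<tau>" if eq: "\<And>i. i < N \<Longrightarrow> \<sigma> i = \<tau> i" for N \<sigma> \<tau>
    proof -
      obtain k n where N: "N = prod_encode (k, n)"
        by (metis prod.exhaust prod_decode_inverse)
      show ?thesis unfolding N H
        by (intro G(2) eq) (simp add: N prod_encode_less_right)
    qed
    have "(\<forall>k. \<exists>\<sigma>. \<forall>n. x \<in> G k n \<sigma>) \<longleftrightarrow> (\<exists>\<sigma>. \<forall>N. x \<in> H N \<sigma>)" for x
    proof
      assume "\<forall>k. \<exists>\<sigma>. \<forall>n. x \<in> G k n \<sigma>"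
      then obtain s where s: "\<And>k n. x \<in> G k n (s k)" by metis
      define \<sigma> where "\<sigma> N = (case prod_decode N of (k, j) \<Rightarrow> s k j)" for N
      have "\<forall>N. x \<in> H N \<sigma>"
        using s by (auto simp: H_def \<sigma>_def split: prod.split)
      then show "\<exists>\<sigma>. \<forall>N. x \<in> H N \<sigma>" by blast
    next
      assume "\<exists>\<sigma>. \<forall>N. x \<in> H N \<sigma>"
      then show "\<forall>k. \<exists>\<sigma>. \<forall>n. x \<in> G k n \<sigma>" by (metis H)
    qed
    then show "(\<Inter>k. A k) = {x. \<exists>\<sigma>. \<forall>n. x \<in> H n \<sigma>}"
      by (simp add: A_eq set_eq_iff)
  qed
qed

section \<open>Measurability of Suslin sets up to null sets\<close>

text \<open>Koenig's lemma in the form of a limit: by the pigeonhole principle, one coordinate after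
  the other can be made constant on an infinite set of indices.\<close>

lemma Koenig_bounded_sequences:
  fixes s :: "nat \<Rightarrow> nat \<Rightarrow> nat"
  assumes bd: "\<And>N i. i < N \<Longrightarrow> s N i \<le> v i"
  shows "\<exists>\<sigma>. \<forall>n. \<exists>N\<ge>n. \<forall>i<n. s N i = \<sigma> i"
proof -
  define P where "P n I \<longleftrightarrow> infinite I \<and> I \<subseteq> {n..}" for n :: nat and I :: "nat set"
  define Q where "Q n I J \<longleftrightarrow> J \<subseteq> I \<and> (\<exists>c. \<forall>N\<in>J. s N n = c)" for n and I J :: "nat set"
  have "\<exists>I. \<forall>n. P n (I n) \<and> Q n (I n) (I (Suc n))"
  proof (rule dependent_nat_choice)
    show "\<exists>I. P 0 I" by (auto simp: P_def intro!: exI[of _ UNIV])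
  next
    fix I n assume P: "P n I"
    define I' where "I' = I - {n}"
    have I': "infinite I'" "\<And>N. N \<in> I' \<Longrightarrow> n < N"
      using P by (auto simp: P_def I'_def nat_less_le)
    have "finite ((\<lambda>N. s N n) ` I')"
      by (rule finite_subset[of _ "{..v n}"]) (auto intro!: bd I')
    from pigeonhole_infinite[OF I'(1) this] obtain a
      where "infinite {N \<in> I'. s N n = s a n}" by blast
    then show "\<exists>J. P (Suc n) J \<and> Q n I J"
      using I' by (intro exI[of _ "{N \<in> I'. s N n = s a n}"]) (auto simp: P_def Q_def I'_def Suc_le_eq)
  qed
  then obtain I where I: "\<And>n. P n (I n)" "\<And>n. Q n (I n) (I (Suc n))" by blast
  then obtain \<sigma> where \<sigma>: "\<And>n N. N \<in> I (Suc n) \<Longrightarrow> s N n = \<sigma> n"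
    unfolding Q_def by metis
  have "decseq I" using I(2) by (intro decseq_SucI) (auto simp: Q_def)
  have "\<exists>N\<ge>n. \<forall>i<n. s N i = \<sigma> i" for n
  proof -
    obtain N where N: "N \<in> I n" using I(1)[of n] unfolding P_def by (metis ex_in_conv finite.emptyI)
    have "s N i = \<sigma> i" if "i < n" for i
      using decseqD[OF \<open>decseq I\<close>, of "Suc i" n] that N by (intro \<sigma>) auto
    moreover have "N \<ge> n" using N I(1)[of n] by (auto simp: P_def)
    ultimately show ?thesis by blast
  qed
  then show ?thesis by blast
qed

text \<open>Outer measure is continuous along increasing sequences of arbitrary sets. So the entries of the
  branches can be bounded, one entry after the other, by numbers \<open>v n\<close> while the outer measure of the
  remaining part of \<open>A\<close> stays above \<open>a\<close>. Below such bounds there are only finitely many initial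
  segments of length \<open>n\<close>, hence the set \<open>C n\<close> of the points that survive up to level \<open>n\<close> is
  measurable; the intersection of the \<open>C n\<close> lies in \<open>A\<close> by Koenig's lemma.\<close>

lemma Suslin_sets_inner_approximation:
  assumes fin: "finite_measure M" and A: "A \<in> Suslin_sets (sets M)"
    and a: "a < outer_measure_of M A"
  shows "\<exists>C\<in>sets M. C \<subseteq> A \<and> a \<le> emeasure M C"
proof -
  interpret finite_measure M by fact
  obtain G where scheme: "Suslin_scheme (sets M) G" and A_eq: "A = {x. \<exists>\<sigma>. \<forall>n. x \<in> G n \<sigma>}"
    using A by (rule Suslin_setsE)
  note G = Suslin_schemeD[OF scheme]
  define B where "B T = {x. \<exists>\<sigma>\<in>T. \<forall>n. x \<in> G n \<sigma>}" for T
  have B_space: "B T \<subseteq> space M" for T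
    using sets.sets_into_space[OF G(1)] by (auto simp: B_def)
  have "\<exists>T. \<forall>n. a < outer_measure_of M (B (T n)) \<and> (n = 0 \<longrightarrow> T n = UNIV)
      \<and> (\<exists>v. T (Suc n) = T n \<inter> {\<sigma>. \<sigma> n \<le> v})"
    unfolding conj_assoc[symmetric]
  proof (rule dependent_nat_choice)
    show "\<exists>T. a < outer_measure_of M (B T) \<and> (0 = (0::nat) \<longrightarrow> T = UNIV)"
      using a by (intro exI[of _ UNIV]) (simp add: B_def A_eq)
  next
    fix T n assume T: "a < outer_measure_of M (B T) \<and> (n = (0::nat) \<longrightarrow> T = UNIV)"
    have "B T = (\<Union>v. B (T \<inter> {\<sigma>. \<sigma> n \<le> v}))"
      by (auto simp: B_def)
    moreover have "incseq (\<lambda>v. B (T \<inter> {\<sigma>. \<sigma> n \<le> v}))"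
      by (force simp: incseq_def B_def)
    ultimately have "outer_measure_of M (B T) = (SUP v. outer_measure_of M (B (T \<inter> {\<sigma>. \<sigma> n \<le> v})))"
      using SUP_outer_measure_of_incseq[of "\<lambda>v. B (T \<inter> {\<sigma>. \<sigma> n \<le> v})" M] B_space by simp
    with T obtain v where "a < outer_measure_of M (B (T \<inter> {\<sigma>. \<sigma> n \<le> v}))"
      by (auto simp: less_SUP_iff)
    then show "\<exists>T'. (a < outer_measure_of M (B T') \<and> (Suc n = 0 \<longrightarrow> T' = UNIV)) \<and>
        (\<exists>v. T' = T \<inter> {\<sigma>. \<sigma> n \<le> v})"
      by blast
  qed
  then obtain T v where T: "\<And>n. a < outer_measure_of M (B (T n))" "T 0 = UNIV"
      "\<And>n. T (Suc n) = T n \<inter> {\<sigma>. \<sigma> n \<le> v n}"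
    by metis
  have T_eq: "T n = {\<sigma>. \<forall>i<n. \<sigma> i \<le> v i}" for n
    by (induction n) (auto simp: T less_Suc_eq)
  \<comment> \<open>only levels \<open>j \<le> n\<close> are tested, and these depend on the entries below \<open>n\<close>, the bounded ones\<close>
  define C where "C n = {x. \<exists>\<sigma>\<in>T n. \<forall>j\<le>n. x \<in> G j \<sigma>}" for n
  have C_eq: "C n = (\<Union>\<sigma>\<in>(\<Pi>\<^sub>E i\<in>{..<n}. {..v i}). \<Inter>j\<in>{..n}. G j \<sigma>)" for n
  proof (intro set_eqI iffI)
    fix x assume "x \<in> C n"
    then obtain \<sigma> where \<sigma>: "\<sigma> \<in> T n" "\<forall>j\<le>n. x \<in> G j \<sigma>" by (auto simp: C_def)
    have "G j (restrict \<sigma> {..<n}) = G j \<sigma>" if "j \<le> n" for j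
      using that by (intro G(2)) auto
    then show "x \<in> (\<Union>\<sigma>\<in>(\<Pi>\<^sub>E i\<in>{..<n}. {..v i}). \<Inter>j\<in>{..n}. G j \<sigma>)"
      using \<sigma> by (intro UN_I[of "restrict \<sigma> {..<n}"]) (auto simp: T_eq)
  next
    fix x assume "x \<in> (\<Union>\<sigma>\<in>(\<Pi>\<^sub>E i\<in>{..<n}. {..v i}). \<Inter>j\<in>{..n}. G j \<sigma>)"
    then obtain \<sigma> where "\<sigma> \<in> (\<Pi>\<^sub>E i\<in>{..<n}. {..v i})" "\<forall>j\<le>n. x \<in> G j \<sigma>" by blast
    moreover from this have "\<sigma> \<in> T n" by (auto simp: T_eq PiE_iff)
    ultimately show "x \<in> C n" unfolding C_def by blast
  qed
  have C_sets: "C n \<in> sets M" for n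
    unfolding C_eq by (intro sets.finite_UN sets.finite_INT finite_PiE G(1)) auto
  have C_dec: "decseq C"
  proof (rule decseq_SucI, rule subsetI)
    fix n x assume "x \<in> C (Suc n)"
    then obtain \<sigma> where "\<sigma> \<in> T (Suc n)" "\<forall>j\<le>Suc n. x \<in> G j \<sigma>" unfolding C_def by blast
    then have "\<sigma> \<in> T n" "\<forall>j\<le>n. x \<in> G j \<sigma>" by (simp_all add: T(3))
    then show "x \<in> C n" unfolding C_def by blast
  qed
  have "a \<le> emeasure M (C n)" for n
  proof -
    have "outer_measure_of M (B (T n)) \<le> outer_measure_of M (C n)"
      unfolding B_def C_def by (intro outer_measure_of_mono) blast
    with T(1)[of n] C_sets show ?thesis by simp
  qed
  then have "a \<le> (INF n. emeasure M (C n))" by (intro INF_greatest)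
  also have "\<dots> = emeasure M (\<Inter>n. C n)"
    using C_sets C_dec by (intro INF_emeasure_decseq) auto
  finally have "a \<le> emeasure M (\<Inter>n. C n)" .
  moreover have "(\<Inter>n. C n) \<subseteq> A"
  proof
    fix x assume "x \<in> (\<Inter>n. C n)"
    then have "\<forall>n. \<exists>\<sigma>. \<sigma> \<in> T n \<and> (\<forall>j\<le>n. x \<in> G j \<sigma>)" unfolding C_def by blast
    then obtain s where s: "\<And>n. s n \<in> T n" "\<And>n j. j \<le> n \<Longrightarrow> x \<in> G j (s n)" by metis
    then obtain \<sigma> where \<sigma>: "\<And>n. \<exists>N\<ge>n. \<forall>i<n. s N i = \<sigma> i"
      using Koenig_bounded_sequences[of s v] by (auto simp: T_eq)
    have "x \<in> G n \<sigma>" for n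
    proof -
      obtain N where "N \<ge> n" "\<forall>i<n. s N i = \<sigma> i" using \<sigma> by blast
      then show ?thesis using s(2)[of n N] G(2)[of n "s N" \<sigma>] by simp
    qed
    then show "x \<in> A" unfolding A_eq by blast
  qed
  ultimately show ?thesis using C_sets by (intro bexI[of _ "\<Inter>n. C n"]) auto
qed

text \<open>By inner approximation, \<open>A\<close> contains a measurable set with the same measure as a measurable
  cover of \<open>A\<close>.\<close>

theorem Suslin_sets_subset_completion:
  assumes fin: "finite_measure M"
  shows "Suslin_sets (sets M) \<subseteq> sets (completion M)"
proof
  interpret finite_measure M by fact
  fix A assume A: "A \<in> Suslin_sets (sets M)"
  have "A \<subseteq> space M"
    using A Suslin_sets_subset_Pow[of "sets M" "space M"] sets.space_closed[of M] by blast
  then obtain E where E: "E \<in> sets M" "A \<subseteq> E" "outer_measure_of M A = emeasure M E"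
    using outer_measure_of_attain by metis
  have "\<exists>C\<in>sets M. C \<subseteq> A \<and> outer_measure_of M A - 1 / of_nat (Suc n) \<le> emeasure M C" for n
  proof (cases "emeasure M E = 0")
    case True
    then show ?thesis using E by (intro bexI[of _ "{}"]) auto
  next
    case False
    then have "outer_measure_of M A - 1 / of_nat (Suc n) < outer_measure_of M A"
      unfolding E(3) by (intro ennreal_between) (use False in \<open>auto simp: zero_less_iff_neq_zero ennreal_zero_less_divide less_top[symmetric]\<close>)
    then show ?thesis by (rule Suslin_sets_inner_approximation[OF fin A])
  qed
  then obtain C where C: "\<And>n. C n \<in> sets M" "\<And>n. C n \<subseteq> A"
      "\<And>n. emeasure M E - 1 / of_nat (Suc n) \<le> emeasure M (C n)"
    unfolding E(3) by metis
  have "emeasure M E \<le> emeasure M (\<Union>n. C n)"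
  proof (rule ennreal_le_epsilon)
    fix e :: real assume "0 < e"
    then obtain n where n: "1 / real (Suc n) < e"
      using nat_approx_posE by blast
    have "1 / of_nat (Suc n) = ennreal (1 / real (Suc n))"
      by (simp add: divide_ennreal[symmetric] ennreal_of_nat_eq_real_of_nat del: of_nat_Suc)
    also have "\<dots> \<le> ennreal e" using n by (intro ennreal_leI) simp
    finally have *: "1 / of_nat (Suc n) \<le> ennreal e" .
    have "emeasure M E - 1 / of_nat (Suc n) \<le> emeasure M (\<Union>n. C n)"
      using C by (intro order_trans[OF C(3)] emeasure_mono) auto
    then have "emeasure M E \<le> emeasure M (\<Union>n. C n) + 1 / of_nat (Suc n)"
      by (simp add: ennreal_minus_le_iff add.commute)
    also have "\<dots> \<le> emeasure M (\<Union>n. C n) + ennreal e" using * by (intro add_left_mono)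
    finally show "emeasure M E \<le> emeasure M (\<Union>n. C n) + ennreal e" .
  qed
  moreover have "emeasure M (\<Union>n. C n) \<le> emeasure M E"
    using C(2) E by (intro emeasure_mono UN_least order_trans[OF C(2) E(2)])
  ultimately have "emeasure M (\<Union>n. C n) = emeasure M E" by simp
  moreover have C_UN: "(\<Union>n. C n) \<in> sets M"
    using C(1) by (intro sets.countable_UN) auto
  ultimately have "emeasure (completion M) (\<Union>n. C n) = emeasure (completion M) E"
    using E(1) by simp
  moreover have "emeasure (completion M) (\<Union>n. C n) < \<infinity>"
    using C_UN emeasure_finite[of "\<Union>n. C n"] by (simp add: less_top[symmetric])
  moreover have "(\<Union>n. C n) \<subseteq> A"
    using C(2) by (rule UN_least)
  ultimately show "A \<in> sets (completion M)"
    using C_UN E(1,2) completion.complete_sets_sandwich[of "\<Union>n. C n" M E A] by simp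
qed

section \<open>Projections along a cube\<close>

definition cube_topology :: "'i set \<Rightarrow> ('i \<Rightarrow> real) topology" where
  "cube_topology I = product_topology (\<lambda>_. top_of_set {0..1}) I"

lemma topspace_cube_topology [simp]: "topspace (cube_topology I) = I \<rightarrow>\<^sub>E {0..1}"
  by (simp add: cube_topology_def)

lemma compact_space_cube_topology: "compact_space (cube_topology I)"
  by (simp add: cube_topology_def compact_space_product_topology compact_space_subtopology)

lemma closedin_cube_topology_slice:
  assumes "i \<in> I" "closed F"
  shows "closedin (cube_topology I) {z \<in> I \<rightarrow>\<^sub>E {0..1}. z i \<in> F}"
proof -
  have "continuous_map (cube_topology I) euclideanreal (\<lambda>z. z i)"
    using continuous_map_product_projection[OF assms(1), of "\<lambda>_. top_of_set {0..1::real}"]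
    unfolding cube_topology_def by (rule continuous_map_into_fulltopology)
  from closedin_continuous_map_preimage[OF this, of F] assms(2) show ?thesis by simp
qed

text \<open>Rectangles with a closed side have compact sections, and a finite intersection of them is again
  a rectangle, whose projection is measurable. Finite unions, whose projections would be less
  direct, are left to the Suslin operation.\<close>

definition measurable_closed_rectangles :: "'a measure \<Rightarrow> 'i set \<Rightarrow> ('a \<times> ('i \<Rightarrow> real)) set set" where
  "measurable_closed_rectangles M I =
     {A \<times> C | A C. A \<in> sets M \<and> closedin (cube_topology I) C}"

text \<open>Complements of Suslin sets need not be Suslin sets, but the sets that are Suslin together with
  their complement form a sigma-algebra. It contains the generators, because the complement of a
  closed half-line is a countable union of closed half-lines.\<close>

lemma sets_pair_cube_subset_Suslin:
  "sets (M \<Otimes>\<^sub>M (\<Pi>\<^sub>M i\<in>I. restrict_space borel {0..1})) \<subseteq> Suslin_sets (measurable_closed_rectangles M I)"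
    (is "sets (M \<Otimes>\<^sub>M ?K) \<subseteq> Suslin_sets ?E")
proof -
  define X where "X = space M \<times> (I \<rightarrow>\<^sub>E {0..1::real})"
  have E_Pow: "?E \<subseteq> Pow X"
    using closedin_subset[of "cube_topology I"] sets.sets_into_space[of _ M]
    unfolding measurable_closed_rectangles_def X_def topspace_cube_topology by blast
  have topspace: "closedin (cube_topology I) (I \<rightarrow>\<^sub>E {0..1})"
    using closedin_topspace[of "cube_topology I"] by simp
  have rect: "A \<times> C \<in> Suslin_sets ?E" if "A \<in> sets M" "closedin (cube_topology I) C" for A C
    using that by (intro Suslin_sets_basic) (auto simp: measurable_closed_rectangles_def)
  have X_E: "X \<in> ?E"
    using topspace by (auto simp: measurable_closed_rectangles_def X_def)
  define D where "D = {A \<in> Suslin_sets ?E. X - A \<in> Suslin_sets ?E}"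
  have "sigma_algebra X D"
    unfolding sigma_algebra_iff2
  proof (intro conjI allI ballI impI)
    show "D \<subseteq> Pow X" using Suslin_sets_subset_Pow[OF E_Pow] by (auto simp: D_def)
    show "{} \<in> D"
      using rect[of "{}" "{}"] Suslin_sets_basic[OF X_E] by (simp add: D_def)
    show "X - A \<in> D" if "A \<in> D" for A
      using that Suslin_sets_subset_Pow[OF E_Pow] by (auto simp: D_def double_diff)
    show "(\<Union>n. A n) \<in> D" if "range A \<subseteq> D" for A :: "nat \<Rightarrow> _"
    proof -
      have "(\<Union>n. A n) \<in> Suslin_sets ?E"
        using that by (intro Suslin_sets_UN[OF _ E_Pow X_E]) (auto simp: D_def)
      moreover have "(\<Inter>n. X - A n) \<in> Suslin_sets ?E"
        using that by (intro Suslin_sets_INT) (auto simp: D_def)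
      moreover have "(\<Inter>n. X - A n) = X - (\<Union>n. A n)" by auto
      ultimately show ?thesis by (simp add: D_def)
    qed
  qed
  then interpret D: sigma_algebra X D .
  define S where "S = sigma X D"
  have S: "space S = X" "sets S = D"
    by (simp_all add: S_def D.space_closed)
  have "fst \<in> S \<rightarrow>\<^sub>M M"
  proof (rule measurableI)
    fix A assume A: "A \<in> sets M"
    have "fst -` A \<inter> X = A \<times> (I \<rightarrow>\<^sub>E {0..1})"
      using sets.sets_into_space[OF A] by (auto simp: X_def)
    moreover have "X - A \<times> (I \<rightarrow>\<^sub>E {0..1}) = (space M - A) \<times> (I \<rightarrow>\<^sub>E {0..1})"
      by (auto simp: X_def)
    ultimately show "fst -` A \<inter> space S \<in> sets S"
      using A topspace by (simp add: S D_def rect)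
  qed (auto simp: S X_def)
  moreover have coord: "(\<lambda>x. snd x i) \<in> borel_measurable S" if i: "i \<in> I" for i
    unfolding borel_measurable_iff_le
  proof
    fix a :: real
    define C where "C F = {z \<in> I \<rightarrow>\<^sub>E {0..1}. z i \<in> F}" for F :: "real set"
    have C: "space M \<times> C F \<in> Suslin_sets ?E" if "closed F" for F
      using closedin_cube_topology_slice[OF i that] by (intro rect) (auto simp: C_def)
    have "{w \<in> X. snd w i \<le> a} = space M \<times> C {..a}"
      by (auto simp: X_def C_def)
    moreover have "X - space M \<times> C {..a} = (\<Union>n. space M \<times> C {a + 1 / real (Suc n)..})"
    proof -
      have "\<exists>n. a + 1 / real (Suc n) \<le> t" if "a < t" for t
      proof -
        obtain n where "1 / real (Suc n) < t - a"
          by (rule nat_approx_posE[of "t - a"]) (use \<open>a < t\<close> in auto)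
        then show ?thesis by (intro exI[of _ n]) simp
      qed
      moreover have "a < t" if "a + 1 / real (Suc n) \<le> t" for t n
        using that zero_less_divide_1_iff[of "real (Suc n)"] by linarith
      ultimately have iff: "a < t \<longleftrightarrow> (\<exists>n. a + 1 / real (Suc n) \<le> t)" for t
        by blast
      show ?thesis
      proof (rule set_eqI)
        fix x
        show "x \<in> X - space M \<times> C {..a} \<longleftrightarrow> x \<in> (\<Union>n. space M \<times> C {a + 1 / real (Suc n)..})"
          using iff[of "snd x i"] by (cases x) (simp add: X_def C_def not_le del: of_nat_Suc, blast)
      qed
    qed
    moreover have "(\<Union>n. space M \<times> C {a + 1 / real (Suc n)..}) \<in> Suslin_sets ?E"
      by (intro Suslin_sets_UN[OF _ E_Pow X_E] C) auto
    ultimately show "{w \<in> space S. snd w i \<le> a} \<in> sets S"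
      using C[of "{..a}"] by (simp add: S D_def)
  qed
  moreover have "(\<lambda>x i. snd x i) \<in> S \<rightarrow>\<^sub>M ?K"
    by (intro measurable_PiM_single' measurable_restrict_space2 coord)
       (auto simp: S X_def PiE_iff space_restrict_space)
  ultimately have "(\<lambda>x. (fst x, snd x)) \<in> S \<rightarrow>\<^sub>M M \<Otimes>\<^sub>M ?K"
    by (intro measurable_Pair) auto
  then have "(\<lambda>x. x) \<in> S \<rightarrow>\<^sub>M M \<Otimes>\<^sub>M ?K" by simp
  have "A \<in> Suslin_sets ?E" if A: "A \<in> sets (M \<Otimes>\<^sub>M ?K)" for A
  proof -
    have "A \<subseteq> X"
      using sets.sets_into_space[OF A] by (auto simp: X_def space_pair_measure space_PiM space_restrict_space)
    moreover have "(\<lambda>x. x) -` A \<inter> space S \<in> sets S"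
      using \<open>(\<lambda>x. x) \<in> S \<rightarrow>\<^sub>M M \<Otimes>\<^sub>M ?K\<close> A by (rule measurable_sets)
    ultimately show ?thesis by (simp add: S D_def Int_absorb2)
  qed
  then show ?thesis by blast
qed

text \<open>Along a fixed branch the existential quantifier over the cube commutes with the intersection over
  the levels: compactness turns a point in each finite intersection of closed sets into a common
  point. So the projection is the Suslin set of the projected finite intersections.\<close>

lemma Suslin_sets_projection:
  assumes "H \<in> Suslin_sets (measurable_closed_rectangles M I)"
  shows "fst ` H \<in> Suslin_sets (sets M)"
proof -
  let ?E = "measurable_closed_rectangles M I"
  obtain G where scheme: "Suslin_scheme ?E G" and H_eq: "H = {x. \<exists>\<sigma>. \<forall>n. x \<in> G n \<sigma>}"
    using assms by (rule Suslin_setsE)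
  note G = Suslin_schemeD[OF scheme]
  define F where "F n \<sigma> = fst ` (\<Inter>j\<in>{..n}. G j \<sigma>)" for n \<sigma>
  have rect: "\<exists>A C. (\<forall>j. A j \<in> sets M \<and> closedin (cube_topology I) (C j) \<and> G j \<sigma> = A j \<times> C j)" for \<sigma>
    using G(1)[of _ \<sigma>] unfolding measurable_closed_rectangles_def mem_Collect_eq by metis
  have Int_rect: "(\<Inter>j\<in>{..n}. A j \<times> C j) = (\<Inter>j\<in>{..n}. A j) \<times> (\<Inter>j\<in>{..n}. C j)"
    for A :: "nat \<Rightarrow> 'a set" and C :: "nat \<Rightarrow> ('b \<Rightarrow> real) set" and n
    by auto
  show ?thesis
  proof (rule Suslin_setsI[where G=F])
    fix n \<sigma>
    from rect[of \<sigma>] obtain A C where AC: "\<And>j. A j \<in> sets M" "\<And>j. G j \<sigma> = A j \<times> C j" by blast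
    have "(\<Inter>j\<in>{..n}. A j) \<in> sets M" using AC by (intro sets.finite_INT) auto
    then show "F n \<sigma> \<in> sets M" by (simp add: F_def AC Int_rect)
  next
    fix n and \<sigma> \<tau> :: "nat \<Rightarrow> nat" assume "\<And>i. i < n \<Longrightarrow> \<sigma> i = \<tau> i"
    then have "G j \<sigma> = G j \<tau>" if "j \<le> n" for j
      using that by (intro G(2)) auto
    then show "F n \<sigma> = F n \<tau>" by (simp add: F_def)
  next
    have "(\<exists>z. \<forall>n. (x, z) \<in> G n \<sigma>) \<longleftrightarrow> (\<forall>n. x \<in> F n \<sigma>)" for x \<sigma>
    proof
      assume *: "\<forall>n. x \<in> F n \<sigma>"
      from rect[of \<sigma>] obtain A C where AC: "\<And>j. closedin (cube_topology I) (C j)" "\<And>j. G j \<sigma> = A j \<times> C j"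
        by blast
      have x: "x \<in> A n" "(\<Inter>j\<in>{..n}. C j) \<noteq> {}" for n
        using *[rule_format, of n] by (auto simp: F_def AC)
      have "(\<Inter>n. \<Inter>j\<in>{..n}. C j) \<noteq> {}"
      proof (rule compact_space_imp_nest[OF compact_space_cube_topology])
        show "closedin (cube_topology I) (\<Inter>j\<in>{..n}. C j)" for n
          using AC by (intro closedin_INT) auto
        show "decseq (\<lambda>n. \<Inter>j\<in>{..n}. C j)"
          by (intro decseq_SucI) auto
      qed (rule x)
      then show "\<exists>z. \<forall>n. (x, z) \<in> G n \<sigma>" using x(1) by (auto simp: AC)
    qed (force simp: F_def)
    then show "fst ` H = {x. \<exists>\<sigma>. \<forall>n. x \<in> F n \<sigma>}"
      by (auto simp: H_eq image_iff) blast+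
  qed
qed

theorem measurable_projection_cube:
  assumes "finite_measure M" "H \<in> sets (M \<Otimes>\<^sub>M (\<Pi>\<^sub>M i\<in>I. restrict_space borel {0..1::real}))"
  shows "fst ` H \<in> sets (completion M)"
proof -
  have "H \<in> Suslin_sets (measurable_closed_rectangles M I)"
    using sets_pair_cube_subset_Suslin assms(2) by (rule subsetD)
  then have "fst ` H \<in> Suslin_sets (sets M)"
    by (rule Suslin_sets_projection)
  then show ?thesis
    by (rule subsetD[OF Suslin_sets_subset_completion[OF assms(1)]])
qed

section \<open>The minimal selection size\<close>

lemma restrict_family_at: "J \<subseteq> I \<Longrightarrow> restrict (family_at I Ys p \<omega>) J = family_at J Ys p \<omega>"
  by (auto simp: family_at_def restrict_def fun_eq_iff)

lemma fun_upd_in_family_space: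
  assumes "i \<in> I" "q \<in> space (family_space (I - {i}) Ys)" "z \<in> space (row_space Ys)"
  shows "q(i := z) \<in> space (family_space I Ys)"
  using assms by (auto simp: space_family_space space_row_space PiE_def extensional_def Pi_def)

lemma measurable_fun_upd_row:
  assumes "i \<in> I"
  shows "(\<lambda>(q, z). q(i := z)) \<in> family_space (I - {i}) Ys \<Otimes>\<^sub>M row_space Ys \<rightarrow>\<^sub>M family_space I Ys"
  using measurable_add_dim[of i "I - {i}" "\<lambda>_. row_space Ys"] insert_Diff[OF assms]
  by (simp add: family_space_def)

definition selected_size :: "real set \<Rightarrow> ((nat \<Rightarrow> real \<Rightarrow> real) \<Rightarrow> nat set) \<Rightarrow> nat \<Rightarrow>
    (nat \<Rightarrow> real \<Rightarrow> real) \<Rightarrow> nat \<Rightarrow> bool" where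
  "selected_size Ys sel i q j \<longleftrightarrow>
     (\<exists>z\<in>space (row_space Ys). i \<in> sel (q(i := z)) \<and> card (sel (q(i := z))) = j)"

lemma s_min_eq:
  "s_min Ys sel i q =
     (if Collect (selected_size Ys sel i q) = {} then 0 else Min (Collect (selected_size Ys sel i q)))"
proof -
  have "{card (sel (q(i := z))) |z. z \<in> Ys \<rightarrow>\<^sub>E {0..1} \<and> i \<in> sel (q(i := z))}
      = Collect (selected_size Ys sel i q)"
    by (auto simp: selected_size_def space_row_space)
  then show ?thesis by (simp only: s_min_def Let_def)
qed

context
  fixes m :: nat and Ys :: "real set" and sel :: "(nat \<Rightarrow> real \<Rightarrow> real) \<Rightarrow> nat set" and i :: nat
  assumes sel: "sel \<in> family_space {1..m} Ys \<rightarrow>\<^sub>M count_space (Pow {1..m})"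
    and i: "i \<in> {1..m}"
begin

lemma selected_size_le:
  assumes q: "q \<in> space (family_space ({1..m} - {i}) Ys)" and j: "selected_size Ys sel i q j"
  shows "j \<le> m"
proof -
  obtain z where z: "z \<in> space (row_space Ys)" "card (sel (q(i := z))) = j"
    using j by (auto simp: selected_size_def)
  have "sel (q(i := z)) \<in> Pow {1..m}"
    using measurable_space[OF sel fun_upd_in_family_space[OF i q z(1)]] by simp
  then have "card (sel (q(i := z))) \<le> card {1..m}"
    by (intro card_mono) auto
  with z show ?thesis by simp
qed

lemma finite_selected_size:
  assumes "q \<in> space (family_space ({1..m} - {i}) Ys)"
  shows "finite (Collect (selected_size Ys sel i q))"
  using selected_size_le[OF assms] by (metis finite_nat_set_iff_bounded_le mem_Collect_eq)

lemma s_min_le_iff: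
  assumes q: "q \<in> space (family_space ({1..m} - {i}) Ys)"
  shows "s_min Ys sel i q \<le> k \<longleftrightarrow>
     (\<forall>j\<in>{..m}. \<not> selected_size Ys sel i q j) \<or> (\<exists>j\<in>{..k}. selected_size Ys sel i q j)"
proof (cases "Collect (selected_size Ys sel i q) = {}")
  case True
  then show ?thesis by (simp add: s_min_eq)
next
  case False
  then obtain j where "selected_size Ys sel i q j" by blast
  moreover from this have "j \<in> {..m}" using selected_size_le[OF q] by blast
  ultimately have "\<not> (\<forall>j\<in>{..m}. \<not> selected_size Ys sel i q j)" by blast
  moreover have "s_min Ys sel i q \<le> k \<longleftrightarrow> (\<exists>j\<in>{..k}. selected_size Ys sel i q j)"
    using Min_le_iff[OF finite_selected_size[OF q] False, of k] False
    by (simp add: s_min_eq) blast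
  ultimately show ?thesis by blast
qed

lemma s_min_le:
  assumes q: "q \<in> space (family_space ({1..m} - {i}) Ys)"
  shows "s_min Ys sel i q \<le> m"
  using s_min_le_iff[OF q, of m] by blast

lemma s_min_le_card:
  assumes P: "P \<in> space (family_space {1..m} Ys)" and sel_i: "i \<in> sel P"
  shows "s_min Ys sel i (restrict P ({1..m} - {i})) \<le> card (sel P)"
proof -
  let ?q = "restrict P ({1..m} - {i})"
  have upd: "?q(i := P i) = P"
    using P i by (auto simp: space_family_space PiE_def extensional_def fun_eq_iff)
  have "P i \<in> space (row_space Ys)"
    using P i by (auto simp: space_family_space space_row_space PiE_iff)
  then have size: "selected_size Ys sel i ?q (card (sel P))"
    using sel_i upd by (auto simp: selected_size_def intro!: bexI[of _ "P i"])
  moreover have "?q \<in> space (family_space ({1..m} - {i}) Ys)"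
    using P by (auto simp: space_family_space)
  ultimately show ?thesis
    by (subst s_min_le_iff) auto
qed

text \<open>Whether a given size occurs among the selections containing \<open>i\<close> is a projection along the cube of
  replacement rows, and sizes are bounded by \<open>m\<close>, so that \<open>s_min_le_iff\<close> involves finitely many
  of these events.\<close>

lemma measurable_s_min_completion:
  assumes fin: "finite_measure M" and X: "X \<in> M \<rightarrow>\<^sub>M family_space ({1..m} - {i}) Ys"
  shows "(\<lambda>\<omega>. s_min Ys sel i (X \<omega>)) \<in> completion M \<rightarrow>\<^sub>M count_space UNIV"
proof -
  have size: "{\<omega> \<in> space M. selected_size Ys sel i (X \<omega>) j} \<in> sets (completion M)" for j
  proof -
    let ?f = "\<lambda>x. sel ((X (fst x))(i := snd x))"
    have "(\<lambda>x. (\<lambda>(q, z). q(i := z)) (X (fst x), snd x)) \<in> M \<Otimes>\<^sub>M row_space Ys \<rightarrow>\<^sub>M family_space {1..m} Ys"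
      by (rule measurable_compose[OF _ measurable_fun_upd_row[OF i]])
         (intro measurable_Pair measurable_snd measurable_compose[OF measurable_fst X])
    then have f: "?f \<in> M \<Otimes>\<^sub>M row_space Ys \<rightarrow>\<^sub>M count_space (Pow {1..m})"
      using measurable_compose[OF _ sel] by simp
    define H where "H = ?f -` {T \<in> Pow {1..m}. i \<in> T \<and> card T = j} \<inter> space (M \<Otimes>\<^sub>M row_space Ys)"
    have "H \<in> sets (M \<Otimes>\<^sub>M row_space Ys)"
      unfolding H_def by (rule measurable_sets[OF f]) auto
    then have "fst ` H \<in> sets (completion M)"
      unfolding row_space_def by (rule measurable_projection_cube[OF fin])
    moreover have "fst ` H = {\<omega> \<in> space M. selected_size Ys sel i (X \<omega>) j}"
    proof (intro set_eqI iffI)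
      fix \<omega> assume "\<omega> \<in> {\<omega> \<in> space M. selected_size Ys sel i (X \<omega>) j}"
      then obtain z where z: "\<omega> \<in> space M" "z \<in> space (row_space Ys)"
          "i \<in> sel ((X \<omega>)(i := z))" "card (sel ((X \<omega>)(i := z))) = j"
        by (auto simp: selected_size_def)
      moreover have "(\<omega>, z) \<in> space (M \<Otimes>\<^sub>M row_space Ys)"
        using z by (simp add: space_pair_measure)
      moreover from this have "?f (\<omega>, z) \<in> Pow {1..m}"
        using measurable_space[OF f] by force
      ultimately have "(\<omega>, z) \<in> H" by (simp add: H_def)
      then show "\<omega> \<in> fst ` H" by force
    qed (auto simp: H_def selected_size_def space_pair_measure)
    ultimately show ?thesis by simp
  qed
  have le: "{\<omega> \<in> space M. s_min Ys sel i (X \<omega>) \<le> k} \<in> sets (completion M)" for k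
  proof -
    have "{\<omega> \<in> space M. s_min Ys sel i (X \<omega>) \<le> k} =
        (space M - (\<Union>j\<in>{..m}. {\<omega> \<in> space M. selected_size Ys sel i (X \<omega>) j})) \<union>
        (\<Union>j\<in>{..k}. {\<omega> \<in> space M. selected_size Ys sel i (X \<omega>) j})"
      using s_min_le_iff[OF measurable_space[OF X]] by auto
    moreover have "space M \<in> sets (completion M)"
      using sets.top[of "completion M"] by simp
    moreover have "(\<Union>j\<in>J. {\<omega> \<in> space M. selected_size Ys sel i (X \<omega>) j}) \<in> sets (completion M)"
      if "finite J" for J
      using that size by (intro sets.finite_UN) auto
    ultimately show ?thesis
      by (simp add: sets.Un sets.Diff)
  qed
  show ?thesis
    unfolding measurable_count_space_eq2_countable
  proof (intro conjI ballI)
    fix k :: nat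
    have "(\<lambda>\<omega>. s_min Ys sel i (X \<omega>)) -` {k} \<inter> space (completion M) =
        {\<omega> \<in> space M. s_min Ys sel i (X \<omega>) \<le> k} -
        (\<Union>j\<in>{..<k}. {\<omega> \<in> space M. s_min Ys sel i (X \<omega>) \<le> j})"
      by (auto simp: not_le) (metis lessThan_iff le_neq_implies_less less_irrefl_nat)
    also have "\<dots> \<in> sets (completion M)"
      using le by (intro sets.Diff sets.finite_UN) auto
    finally show "(\<lambda>\<omega>. s_min Ys sel i (X \<omega>)) -` {k} \<inter> space (completion M) \<in> sets (completion M)" .
  qed auto
qed

end

section \<open>Replacing the random level by one that depends on \<open>W\<close> alone\<close>

text \<open>Only the finitely many points \<open>c * k\<close> enter in the definition of the crossing index, so it is
  measurable in any parameter in which each \<open>g (c * k)\<close> is. With \<open>g u = l\<close> and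
  \<open>u \<le> c * l\<close>, antitonicity gives \<open>g (c * l) \<le> l\<close>, so \<open>l\<close> competes for the minimum; and
  \<open>u > c * k\<close> would imply \<open>g u \<le> g (c * k) \<le> k\<close>, hence \<open>u \<le> c * k\<close> after all.\<close>

lemma antitone_first_crossing:
  fixes g :: "real \<Rightarrow> nat"
  assumes anti: "antimono_on {0..1} g" and c: "0 \<le> c" "c * real m \<le> 1"
    and g: "\<And>u. u \<in> {0..1} \<Longrightarrow> 1 \<le> g u \<and> g u \<le> m" and u: "u \<in> {0..1}" "u \<le> c * real (g u)"
  defines "k \<equiv> LEAST k. k \<in> {1..m} \<and> g (c * real k) \<le> k"
  shows "k \<le> g u" and "u \<le> c * real k"
proof -
  have ck: "c * real l \<in> {0..1}" if "l \<le> m" for l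
    using mult_left_mono[of "real l" "real m" c] that c by auto
  have "g (c * real (g u)) \<le> g u"
    using monotone_onD[OF anti, of u "c * real (g u)"] u ck g by auto
  then have P: "g u \<in> {1..m} \<and> g (c * real (g u)) \<le> g u"
    using g u by auto
  then show "k \<le> g u" unfolding k_def by (rule Least_le)
  have k: "k \<in> {1..m} \<and> g (c * real k) \<le> k"
    unfolding k_def by (rule LeastI[where P="\<lambda>k. k \<in> {1..m} \<and> g (c * real k) \<le> k", OF P])
  show "u \<le> c * real k"
  proof (rule ccontr)
    assume *: "\<not> u \<le> c * real k"
    then have "g u \<le> g (c * real k)"
      using monotone_onD[OF anti, of "c * real k" u] u ck[of k] k by auto
    with k have "c * real (g u) \<le> c * real k" using c by (intro mult_left_mono) auto
    with * u show False by simp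
  qed
qed

lemma prob_given_le_imp_measure_le:
  assumes M: "prob_space M" and W: "W \<in> M \<rightarrow>\<^sub>M N" and E: "E \<in> sets M" and B: "B \<in> sets N"
    and le: "AE \<omega> in M. prob_given M N W E \<omega> \<le> t"
  shows "measure M (E \<inter> (W -` B \<inter> space M)) \<le> t * measure M (W -` B \<inter> space M)"
proof -
  interpret prob_space M by fact
  define F where "F = vimage_algebra (space M) W N"
  have sub: "subalgebra M F"
    unfolding subalgebra_def F_def using W
    by (auto simp: sets_vimage_algebra2 measurable_def)
  interpret finite_measure_subalgebra M F
    by unfold_locales (rule sub)
  define A where "A = W -` B \<inter> space M"
  have A_F: "A \<in> sets F" unfolding A_def F_def using B by (rule in_vimage_algebra)
  have A: "A \<in> sets M" unfolding A_def using W B by (rule measurable_sets)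
  have int_E: "integrable M (indicat_real E)" using E by (simp add: less_top[symmetric])
  have "measure M (E \<inter> A) = (\<integral>\<omega>\<in>A. indicat_real E \<omega> \<partial>M)"
    using A E by (simp add: set_lebesgue_integral_def indicator_inter_arith[symmetric] Int_commute)
  also have "\<dots> = (\<integral>\<omega>\<in>A. real_cond_exp M F (indicat_real E) \<omega> \<partial>M)"
    using int_E A_F by (rule real_cond_exp_intA)
  also have "\<dots> \<le> (\<integral>\<omega>\<in>A. t \<partial>M)"
    unfolding set_lebesgue_integral_def
  proof (rule integral_mono_AE)
    show "integrable M (\<lambda>x. indicator A x *\<^sub>R real_cond_exp M F (indicat_real E) x)"
      using integrable_mult_indicator[OF A real_cond_exp_int(1)[OF int_E]] .
    show "integrable M (\<lambda>x. indicator A x *\<^sub>R t)"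
      using A by (simp add: less_top[symmetric])
    show "AE x in M. indicator A x *\<^sub>R real_cond_exp M F (indicat_real E) x \<le> indicator A x *\<^sub>R t"
      using le unfolding prob_given_def F_def[symmetric]
      by eventually_elim (auto simp: indicator_def)
  qed
  also have "\<dots> = t * measure M A"
    using A by (simp add: set_lebesgue_integral_def)
  finally show ?thesis by (simp add: A_def)
qed

text \<open>On each of the disjoint events \<open>K (W \<omega>) = k\<close>, which are determined by \<open>W\<close>, the level is
  the constant \<open>c * k\<close>; the weight \<open>1 / k\<close> cancels the factor \<open>k\<close> in the bound on the conditional
  probability. The dominating function \<open>h\<close> is measurable because \<open>K\<close> is replaced by a measurable version,
  equal to it almost surely.\<close>

lemma superuniform_random_level:
  fixes K :: "'w \<Rightarrow> nat"
  assumes M: "prob_space M" and W: "W \<in> M \<rightarrow>\<^sub>M N" and U: "U \<in> borel_measurable M"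
    and super: "\<And>t. t \<in> {0..1} \<Longrightarrow> AE \<omega> in M. prob_given M N W {\<omega>' \<in> space M. U \<omega>' \<le> t} \<omega> \<le> t"
    and K: "K \<in> completion (distr M N W) \<rightarrow>\<^sub>M count_space UNIV"
    and K_range: "\<And>w. w \<in> space N \<Longrightarrow> K w \<in> {1..m}"
    and c: "0 \<le> c" "c * real m \<le> 1"
  obtains h where "integrable M h" "integral\<^sup>L M h \<le> c"
    "AE \<omega> in M. of_bool (U \<omega> \<le> c * real (K (W \<omega>))) / real (K (W \<omega>)) \<le> h \<omega>"
proof -
  interpret prob_space M by fact
  have "(\<lambda>w. real (K w)) \<in> borel_measurable (completion (distr M N W))"
    using K by (rule measurable_compose) simp
  then obtain K' where K': "K' \<in> borel_measurable (distr M N W)" "AE w in distr M N W. real (K w) = K' w"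
    using completion_ex_borel_measurable_real by blast
  have K'_N: "K' \<in> borel_measurable N" using K'(1) by simp
  define B where "B k = K' -` {real k} \<inter> space N" for k :: nat
  have B: "B k \<in> sets N" for k
    unfolding B_def using K'_N by (rule measurable_sets) simp
  define A where "A k = W -` B k \<inter> space M" for k
  have A: "A k \<in> sets M" for k unfolding A_def using W B by (rule measurable_sets)
  define E where "E k = {\<omega> \<in> space M. U \<omega> \<le> c * real k}" for k
  have E: "E k \<in> sets M" for k unfolding E_def using U by measurable
  define h where "h \<omega> = (\<Sum>k\<in>{1..m}. indicat_real (E k \<inter> A k) \<omega> / real k)" for \<omega>
  have int: "integrable M (\<lambda>\<omega>. indicat_real (E k \<inter> A k) \<omega> / real k)" for k
    using A E by (simp add: less_top[symmetric])
  have "integrable M h"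
    unfolding h_def by (intro Bochner_Integration.integrable_sum int)
  moreover have "integral\<^sup>L M h \<le> c"
  proof -
    have "integral\<^sup>L M h = (\<Sum>k\<in>{1..m}. measure M (E k \<inter> A k) / real k)"
      unfolding h_def using A E int by (subst Bochner_Integration.integral_sum) (simp_all add: sets.Int)
    also have "\<dots> \<le> (\<Sum>k\<in>{1..m}. c * measure M (A k))"
    proof (rule sum_mono)
      fix k assume k: "k \<in> {1..m}"
      have "c * real k \<in> {0..1}"
        using mult_left_mono[of "real k" "real m" c] k c by auto
      then have "measure M (E k \<inter> A k) \<le> (c * real k) * measure M (A k)"
        using prob_given_le_imp_measure_le[OF M W E B super[of "c * real k", folded E_def]]
        unfolding A_def by blast
      then show "measure M (E k \<inter> A k) / real k \<le> c * measure M (A k)"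
        using k by (simp add: divide_le_eq mult_ac)
    qed
    also have "\<dots> = c * measure M (\<Union>k\<in>{1..m}. A k)"
    proof -
      have "disjoint_family_on A {1..m}"
        by (auto simp: disjoint_family_on_def A_def B_def)
      then have "measure M (\<Union>k\<in>{1..m}. A k) = (\<Sum>k\<in>{1..m}. measure M (A k))"
        using A by (intro finite_measure_finite_Union) auto
      then show ?thesis by (simp add: sum_distrib_left)
    qed
    also have "\<dots> \<le> c * 1"
      using c by (intro mult_left_mono) auto
    finally show ?thesis by simp
  qed
  moreover have "AE \<omega> in M. of_bool (U \<omega> \<le> c * real (K (W \<omega>))) / real (K (W \<omega>)) \<le> h \<omega>"
  proof -
    have "AE \<omega> in M. real (K (W \<omega>)) = K' (W \<omega>)"
      using K'(2) by (rule AE_distrD[OF W])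
    then show ?thesis
    proof (rule AE_mp, intro AE_I2 impI)
      fix \<omega> assume \<omega>: "\<omega> \<in> space M" and eq: "real (K (W \<omega>)) = K' (W \<omega>)"
      let ?k = "K (W \<omega>)"
      have W\<omega>: "W \<omega> \<in> space N" using W \<omega> by (rule measurable_space)
      have nonneg: "0 \<le> indicat_real (E k \<inter> A k) \<omega> / real k" for k by simp
      have "\<omega> \<in> A ?k" using \<omega> W\<omega> eq by (simp add: A_def B_def)
      then have "of_bool (U \<omega> \<le> c * real ?k) / real ?k = indicat_real (E ?k \<inter> A ?k) \<omega> / real ?k"
        using \<omega> by (simp add: E_def indicator_def)
      also have "\<dots> \<le> h \<omega>"
        unfolding h_def using K_range[OF W\<omega>] nonneg by (intro member_le_sum) auto
      finally show "of_bool (U \<omega> \<le> c * real ?k) / real ?k \<le> h \<omega>" .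
    qed
  qed
  ultimately show thesis by (rule that)
qed

section \<open>Control of the false coverage proportion\<close>

text \<open>Here \<open>Q\<close> plays the role of the other rows and \<open>U\<close> that of the value at the true label. The
  integrand on the left of the last line need not be measurable, so its bound is stated through an
  integrable majorant.\<close>

lemma expected_error_share_le:
  fixes \<Psi> :: "real \<Rightarrow> 'w \<Rightarrow> (nat \<Rightarrow> real \<Rightarrow> real)"
  assumes M: "prob_space M" and W: "W \<in> M \<rightarrow>\<^sub>M N"
    and U: "U \<in> borel_measurable M" and U_range: "\<And>\<omega>. \<omega> \<in> space M \<Longrightarrow> U \<omega> \<in> {0..1}"
    and super: "\<And>t. t \<in> {0..1} \<Longrightarrow> AE \<omega> in M. prob_given M N W {\<omega>' \<in> space M. U \<omega>' \<le> t} \<omega> \<le> t"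
    and \<Psi>_meas: "\<And>u. u \<in> {0..1} \<Longrightarrow> \<Psi> u \<in> N \<rightarrow>\<^sub>M family_space ({1..m} - {i}) Ys"
    and \<Psi>: "AE \<omega> in M. Q \<omega> = \<Psi> (U \<omega>) (W \<omega>) \<and> mono_on {0..1} (\<lambda>u. \<Psi> u (W \<omega>))"
    and sel: "sel \<in> family_space {1..m} Ys \<rightarrow>\<^sub>M count_space (Pow {1..m})" and i: "i \<in> {1..m}"
    and anti: "antimono_on (space (family_space ({1..m} - {i}) Ys)) (s_min Ys sel i)"
    and c: "0 \<le> c" "c * real m \<le> 1"
  obtains h where "integrable M h" "integral\<^sup>L M h \<le> c"
    "AE \<omega> in M. of_bool (U \<omega> \<le> c * real (max 1 (s_min Ys sel i (Q \<omega>))))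
       / real (max 1 (s_min Ys sel i (Q \<omega>))) \<le> h \<omega>"
proof -
  interpret prob_space M by fact
  define g where "g w u = max 1 (s_min Ys sel i (\<Psi> u w))" for w u
  define K where "K w = (LEAST k. k \<in> {1..m} \<and> g w (c * real k) \<le> k)" for w
  have ck: "c * real l \<in> {0..1}" if "l \<le> m" for l
    using mult_left_mono[of "real l" "real m" c] that c by auto
  have g_range: "1 \<le> g w u \<and> g w u \<le> m" if "w \<in> space N" "u \<in> {0..1}" for w u
    using s_min_le[OF sel i measurable_space[OF \<Psi>_meas that(1)]] that i by (auto simp: g_def)
  have K_range: "K w \<in> {1..m}" if w: "w \<in> space N" for w
  proof -
    have "m \<in> {1..m} \<and> g w (c * real m) \<le> m"
      using g_range[OF w ck[of m]] i by auto
    from LeastI[where P="\<lambda>k. k \<in> {1..m} \<and> g w (c * real k) \<le> k", OF this]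
    show ?thesis by (simp add: K_def)
  qed
  let ?C = "completion (distr M N W)"
  have "finite_measure (distr M N W)"
    using prob_space.finite_measure[OF prob_space_distr[OF W]] .
  have K_meas: "K \<in> ?C \<rightarrow>\<^sub>M count_space UNIV"
    unfolding K_def
  proof (rule measurable_Least)
    fix k :: nat
    show "(\<lambda>w. k \<in> {1..m} \<and> g w (c * real k) \<le> k) \<in> ?C \<rightarrow>\<^sub>M count_space UNIV"
    proof (cases "k \<in> {1..m}")
      case True
      then have "\<Psi> (c * real k) \<in> distr M N W \<rightarrow>\<^sub>M family_space ({1..m} - {i}) Ys"
        using \<Psi>_meas[OF ck[of k]] by simp
      then have "(\<lambda>w. s_min Ys sel i (\<Psi> (c * real k) w)) \<in> ?C \<rightarrow>\<^sub>M count_space UNIV"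
        by (rule measurable_s_min_completion[OF sel i \<open>finite_measure _\<close>])
      then have "(\<lambda>w. max 1 (s_min Ys sel i (\<Psi> (c * real k) w)) \<le> k) \<in> ?C \<rightarrow>\<^sub>M count_space UNIV"
        by (rule measurable_compose) simp
      moreover have "(\<lambda>w. k \<in> {1..m} \<and> g w (c * real k) \<le> k) =
          (\<lambda>w. max 1 (s_min Ys sel i (\<Psi> (c * real k) w)) \<le> k)"
        using True unfolding g_def by blast
      ultimately show ?thesis by (simp only:)
    next
      case False
      then have "(\<lambda>w. k \<in> {1..m} \<and> g w (c * real k) \<le> k) = (\<lambda>w. False)"
        by blast
      then show ?thesis by (simp only: measurable_const space_count_space UNIV_I)
    qed
  qed
  obtain h where h: "integrable M h" "integral\<^sup>L M h \<le> c"
      "AE \<omega> in M. of_bool (U \<omega> \<le> c * real (K (W \<omega>))) / real (K (W \<omega>)) \<le> h \<omega>"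
    by (rule superuniform_random_level[OF M W U super K_meas K_range c])
  have "AE \<omega> in M. of_bool (U \<omega> \<le> c * real (max 1 (s_min Ys sel i (Q \<omega>))))
       / real (max 1 (s_min Ys sel i (Q \<omega>))) \<le> h \<omega>"
    using h(3) \<Psi> AE_space
  proof eventually_elim
    case (elim \<omega>)
    have w: "W \<omega> \<in> space N" using W elim(3) by (rule measurable_space)
    have U\<omega>: "U \<omega> \<in> {0..1}" using U_range elim(3) .
    have Q: "max 1 (s_min Ys sel i (Q \<omega>)) = g (W \<omega>) (U \<omega>)"
      using elim(2) by (simp add: g_def)
    have h_nonneg: "0 \<le> h \<omega>"
      by (rule order_trans[OF _ elim(1)]) simp
    show ?case
    proof (cases "U \<omega> \<le> c * real (g (W \<omega>) (U \<omega>))")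
      case False
      then show ?thesis unfolding Q using h_nonneg by simp
    next
      case True
      have "antimono_on {0..1} (g (W \<omega>))"
      proof (rule monotone_onI)
        fix u v :: real assume uv: "u \<in> {0..1}" "v \<in> {0..1}" "u \<le> v"
        have "\<Psi> u (W \<omega>) \<le> \<Psi> v (W \<omega>)"
          using conjunct2[OF elim(2)] uv by (rule mono_onD)
        then have "s_min Ys sel i (\<Psi> v (W \<omega>)) \<le> s_min Ys sel i (\<Psi> u (W \<omega>))"
          using monotone_onD[OF anti measurable_space[OF \<Psi>_meas w] measurable_space[OF \<Psi>_meas w]] uv
          by blast
        then show "g (W \<omega>) v \<le> g (W \<omega>) u" by (simp add: g_def max_def)
      qed
      note crossing = antitone_first_crossing[OF this c g_range[OF w] U\<omega> True, folded K_def]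
      have "1 / real (g (W \<omega>) (U \<omega>)) \<le> 1 / real (K (W \<omega>))"
        using crossing(1) K_range[OF w] by (intro divide_left_mono) auto
      also have "\<dots> \<le> h \<omega>"
        using elim(1) crossing(2) by simp
      finally show ?thesis unfolding Q using True by simp
    qed
  qed
  with h(1,2) show thesis by (rule that)
qed

theorem theoremC1:
  fixes M :: "'a measure"
    and N :: "nat \<Rightarrow> 'w measure"
    and m :: nat
    and \<alpha> :: real
    and Ys :: "real set"
    and p :: "nat \<Rightarrow> real \<Rightarrow> 'a \<Rightarrow> real"
    and Y :: "nat \<Rightarrow> 'a \<Rightarrow> real"
    and W :: "nat \<Rightarrow> 'a \<Rightarrow> 'w"
    and \<Psi> :: "nat \<Rightarrow> real \<Rightarrow> 'w \<Rightarrow> (nat \<Rightarrow> real \<Rightarrow> real)"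
    and sel :: "(nat \<Rightarrow> real \<Rightarrow> real) \<Rightarrow> nat set"
  assumes M: "prob_space M"
    and \<alpha>: "0 < \<alpha>" "\<alpha> < 1"
    and m: "m \<ge> 1"
    \<comment> \<open>the random family and the random outcomes\<close>
    and p_meas: "\<And>i y. i \<in> {1..m} \<Longrightarrow> y \<in> Ys \<Longrightarrow> p i y \<in> borel_measurable M"
    and p_range: "\<And>i y \<omega>. i \<in> {1..m} \<Longrightarrow> y \<in> Ys \<Longrightarrow> \<omega> \<in> space M \<Longrightarrow> p i y \<omega> \<in> {0..1}"
    and Y_meas: "\<And>i. i \<in> {1..m} \<Longrightarrow> Y i \<in> borel_measurable M"
    and Y_range: "\<And>i \<omega>. i \<in> {1..m} \<Longrightarrow> \<omega> \<in> space M \<Longrightarrow> Y i \<omega> \<in> Ys"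
    and pY_meas: "\<And>i. i \<in> {1..m} \<Longrightarrow> (\<lambda>\<omega>. p i (Y i \<omega>) \<omega>) \<in> borel_measurable M"
    \<comment> \<open>(P): \<open>W i\<close> is a random element of \<open>N i\<close>, and \<open>\<Psi> i u (W i)\<close> is a random family for each \<open>u\<close>\<close>
    and W_meas: "\<And>i. i \<in> {1..m} \<Longrightarrow> W i \<in> M \<rightarrow>\<^sub>M N i"
    and \<Psi>_meas: "\<And>i u. i \<in> {1..m} \<Longrightarrow> u \<in> {0..1} \<Longrightarrow>
                   \<Psi> i u \<in> N i \<rightarrow>\<^sub>M family_space ({1..m} - {i}) Ys"
    and P_i: "\<And>i. i \<in> {1..m} \<Longrightarrow>
                AE \<omega> in M. family_at ({1..m} - {i}) Ys p \<omega> = \<Psi> i (p i (Y i \<omega>) \<omega>) (W i \<omega>)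
                  \<and> mono_on {0..1} (\<lambda>u. \<Psi> i u (W i \<omega>))"
    and P_ii: "\<And>i t. i \<in> {1..m} \<Longrightarrow> t \<in> {0..1} \<Longrightarrow>
                AE \<omega> in M. prob_given M (N i) (W i) {\<omega>' \<in> space M. p i (Y i \<omega>') \<omega>' \<le> t} \<omega> \<le> t"
    \<comment> \<open>the selection rule and (S)\<close>
    and sel_meas: "sel \<in> family_space {1..m} Ys \<rightarrow>\<^sub>M count_space (Pow {1..m})"
    and S: "\<And>i. i \<in> {1..m} \<Longrightarrow>
              antimono_on (space (family_space ({1..m} - {i}) Ys)) (s_min Ys sel i)"
  defines "fcp \<equiv> (\<lambda>\<omega>. let P = family_at {1..m} Ys p \<omega>
                       in FCP (sel P) (prediction_set Ys m \<alpha> sel P) (\<lambda>i. Y i \<omega>))"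
  \<comment> \<open>the first two conjuncts say that the third is not an artefact of non-measurability:
      \<open>fcp\<close> is measurable up to null sets and its expectation is bounded in that sense too\<close>
  shows "fcp \<in> borel_measurable (completion M)
       \<and> integral\<^sup>L (completion M) fcp \<le> \<alpha>
       \<and> prob_space.expectation M fcp \<le> \<alpha>"
proof -
  interpret prob_space M by fact
  define I where "I = {1..m}"
  define c where "c = \<alpha> / real m"
  have c: "0 \<le> c" "c * real m \<le> 1" and card_c: "real (card I) * c = \<alpha>"
    using \<alpha> m by (auto simp: c_def I_def)
  define U where "U i \<omega> = p i (Y i \<omega>) \<omega>" for i \<omega>
  define T where "T \<omega> = sel (family_at {1..m} Ys p \<omega>)" for \<omega>
  define A where "A i \<omega> = max 1 (s_min Ys sel i (family_at ({1..m} - {i}) Ys p \<omega>))" for i \<omega>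
  define r where "r i \<omega> = of_bool (i \<in> T \<omega> \<and> U i \<omega> \<le> c * real (A i \<omega>)) / real (max 1 (card (T \<omega>)))"
    for i \<omega>
  have family: "family_at J Ys p \<in> M \<rightarrow>\<^sub>M family_space J Ys" if "J \<subseteq> {1..m}" for J
    using p_meas p_range that by (intro measurable_family_at) blast+
  have T_meas: "T \<in> M \<rightarrow>\<^sub>M count_space (Pow {1..m})"
    unfolding T_def using measurable_compose[OF family[OF order_refl] sel_meas] .
  have fcp_eq: "fcp \<omega> = (\<Sum>i\<in>I. r i \<omega>)" if \<omega>: "\<omega> \<in> space M" for \<omega>
  proof -
    have T_sub: "T \<omega> \<subseteq> I"
      using measurable_space[OF T_meas \<omega>] by (simp add: I_def)
    have miss: "Y i \<omega> \<notin> prediction_set Ys m \<alpha> sel (family_at {1..m} Ys p \<omega>) i \<longleftrightarrow> U i \<omega> \<le> c * real (A i \<omega>)"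
      if "i \<in> I" for i
    proof -
      have "family_at {1..m} Ys p \<omega> i (Y i \<omega>) = U i \<omega>"
        using that Y_range[OF _ \<omega>] by (simp add: family_at_def U_def I_def)
      then show ?thesis
        using that Y_range[OF _ \<omega>]
        by (simp add: prediction_set_def restrict_family_at A_def c_def I_def not_less)
    qed
    have "fcp \<omega> = (\<Sum>i\<in>T \<omega>. of_bool (Y i \<omega> \<notin> prediction_set Ys m \<alpha> sel (family_at {1..m} Ys p \<omega>) i))
        / real (max 1 (card (T \<omega>)))"
      by (simp add: fcp_def Let_def FCP_def T_def)
    also have "\<dots> = (\<Sum>i\<in>T \<omega>. r i \<omega>)"
      unfolding sum_divide_distrib using T_sub miss by (intro sum.cong) (auto simp: r_def)
    also have "\<dots> = (\<Sum>i\<in>I. r i \<omega>)"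
      using T_sub by (intro sum.mono_neutral_left) (auto simp: r_def I_def)
    finally show ?thesis .
  qed
  have r_meas: "r i \<in> borel_measurable (completion M)" if i: "i \<in> I" for i
  proof -
    have T': "T \<in> completion M \<rightarrow>\<^sub>M count_space (Pow {1..m})"
      using T_meas by (rule measurable_completion)
    have "(\<lambda>\<omega>. real (max 1 (card (T \<omega>)))) \<in> borel_measurable (completion M)"
      using T' by (rule measurable_compose) simp
    moreover have "(\<lambda>\<omega>. i \<in> T \<omega>) \<in> completion M \<rightarrow>\<^sub>M count_space UNIV"
      using T' by (rule measurable_compose) simp
    moreover have "U i \<in> borel_measurable (completion M)"
      unfolding U_def using pY_meas i by (intro measurable_completion) (simp add: I_def)
    moreover have "(\<lambda>\<omega>. real (A i \<omega>)) \<in> borel_measurable (completion M)"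
    proof -
      have "(\<lambda>\<omega>. s_min Ys sel i (family_at ({1..m} - {i}) Ys p \<omega>)) \<in> completion M \<rightarrow>\<^sub>M count_space UNIV"
        using i by (intro measurable_s_min_completion[OF sel_meas] family finite_measure_axioms)
          (auto simp: I_def)
      then show ?thesis unfolding A_def by (rule measurable_compose) simp
    qed
    ultimately show ?thesis unfolding r_def by measurable
  qed
  have fcp_meas: "fcp \<in> borel_measurable (completion M)"
  proof -
    have "(\<lambda>\<omega>. \<Sum>i\<in>I. r i \<omega>) \<in> borel_measurable (completion M)"
      by (intro borel_measurable_sum r_meas)
    then show ?thesis
      by (rule measurable_cong[THEN iffD1, rotated]) (simp add: fcp_eq)
  qed
  have "\<forall>i\<in>I. \<exists>h. integrable M h \<and> integral\<^sup>L M h \<le> c \<and>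
      (AE \<omega> in M. of_bool (U i \<omega> \<le> c * real (A i \<omega>)) / real (A i \<omega>) \<le> h \<omega>)"
  proof
    fix i assume "i \<in> I"
    then have i: "i \<in> {1..m}" by (simp add: I_def)
    have U_meas: "U i \<in> borel_measurable M" unfolding U_def using pY_meas[OF i] .
    have U_range: "U i \<omega> \<in> {0..1}" if "\<omega> \<in> space M" for \<omega>
      unfolding U_def using p_range[OF i Y_range[OF i that] that] .
    obtain h where "integrable M h" "integral\<^sup>L M h \<le> c"
        "AE \<omega> in M. of_bool (U i \<omega> \<le> c * real (A i \<omega>)) / real (A i \<omega>) \<le> h \<omega>"
      unfolding A_def
      by (rule expected_error_share_le[OF M W_meas[OF i] U_meas U_range P_ii[OF i, folded U_def] \<Psi>_meas[OF i]
          P_i[OF i, folded U_def] sel_meas i S[OF i] c])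
    then show "\<exists>h. integrable M h \<and> integral\<^sup>L M h \<le> c \<and>
        (AE \<omega> in M. of_bool (U i \<omega> \<le> c * real (A i \<omega>)) / real (A i \<omega>) \<le> h \<omega>)"
      by (intro exI[of _ h] conjI)
  qed
  from bchoice[OF this] obtain h where h_all: "\<forall>i\<in>I. integrable M (h i) \<and> integral\<^sup>L M (h i) \<le> c \<and>
      (AE \<omega> in M. of_bool (U i \<omega> \<le> c * real (A i \<omega>)) / real (A i \<omega>) \<le> h i \<omega>)"
    by (rule exE)
  have h: "integrable M (h i)" "integral\<^sup>L M (h i) \<le> c"
      "AE \<omega> in M. of_bool (U i \<omega> \<le> c * real (A i \<omega>)) / real (A i \<omega>) \<le> h i \<omega>" if "i \<in> I" for i
    using bspec[OF h_all that] by blast+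
  define H where "H \<omega> = (\<Sum>i\<in>I. h i \<omega>)" for \<omega>
  have r_le: "r i \<omega> \<le> of_bool (U i \<omega> \<le> c * real (A i \<omega>)) / real (A i \<omega>)"
    if i: "i \<in> I" and \<omega>: "\<omega> \<in> space M" for i \<omega>
  proof (cases "i \<in> T \<omega> \<and> U i \<omega> \<le> c * real (A i \<omega>)")
    case True
    have "A i \<omega> \<le> max 1 (card (T \<omega>))"
      using s_min_le_card[OF sel_meas i[unfolded I_def] measurable_space[OF family[OF order_refl] \<omega>]] True
      by (simp add: A_def T_def restrict_family_at)
    then have "1 / real (max 1 (card (T \<omega>))) \<le> 1 / real (A i \<omega>)"
      by (intro divide_left_mono) (auto simp: A_def)
    with True show ?thesis by (simp add: r_def)
  qed (auto simp: r_def)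
  have H_int: "integrable M H" unfolding H_def by (intro Bochner_Integration.integrable_sum h(1))
  have "integral\<^sup>L M H = (\<Sum>i\<in>I. integral\<^sup>L M (h i))"
    unfolding H_def by (intro Bochner_Integration.integral_sum h(1))
  also have "\<dots> \<le> (\<Sum>i\<in>I. c)" by (intro sum_mono h(2))
  finally have H_le: "integral\<^sup>L M H \<le> \<alpha>" using card_c by simp
  have "AE \<omega> in M. \<forall>i\<in>I. of_bool (U i \<omega> \<le> c * real (A i \<omega>)) / real (A i \<omega>) \<le> h i \<omega>"
    by (intro AE_finite_allI h(3)) (simp add: I_def)
  then have "AE \<omega> in M. fcp \<omega> \<le> H \<omega>"
    using AE_space
  proof eventually_elim
    case (elim \<omega>)
    then have "(\<Sum>i\<in>I. r i \<omega>) \<le> H \<omega>"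
      unfolding H_def by (intro sum_mono order_trans[OF r_le]) auto
    then show ?case using fcp_eq[OF elim(2)] by simp
  qed
  then have fcp_le: "AE \<omega> in completion M. fcp \<omega> \<le> H \<omega>" by (rule AE_completion)
  have fcp_nonneg: "0 \<le> fcp \<omega>" for \<omega>
    by (simp add: fcp_def Let_def FCP_def sum_nonneg)
  have H_comp: "integrable (completion M) H" "integral\<^sup>L (completion M) H = integral\<^sup>L M H"
    using H_int borel_measurable_integrable[OF H_int]
    by (simp_all add: integrable_completion integral_completion)
  have "integrable (completion M) fcp"
    using fcp_le by (intro Bochner_Integration.integrable_bound[OF H_comp(1) fcp_meas])
      (auto simp: fcp_nonneg elim!: eventually_mono)
  then have "integral\<^sup>L (completion M) fcp \<le> integral\<^sup>L (completion M) H"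
    using H_comp(1) fcp_le by (rule integral_mono_AE)
  with H_comp H_le have completion_le: "integral\<^sup>L (completion M) fcp \<le> \<alpha>" by simp
  \<comment> \<open>the Bochner integral of a non-measurable function is \<open>0\<close>\<close>
  have "integral\<^sup>L M fcp \<le> \<alpha>"
  proof (cases "fcp \<in> borel_measurable M")
    case True
    with completion_le show ?thesis by (simp add: integral_completion)
  next
    case False
    then have "\<not> integrable M fcp" by (auto dest: borel_measurable_integrable)
    then show ?thesis using \<alpha> by (simp add: not_integrable_integral_eq)
  qed
  with fcp_meas completion_le show ?thesis by simp
qed

end
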